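(* Suppose $(X,x_0)$ is a pointed topological space. The following subgroups of $\pi_1(X,x_0)$ are closed: (a) subgroups $H$ containing $\pi(\mathcal{U},x_0)$ for some open cover $\mathcal{U}$ of $X$; (b) $\bigcap_{\mathcal{U}\in S}\pi(\mathcal{U},x_0)$ for any family $S$ of open covers of $X$; (c) the kernel of $\pi_1(f)\colon \pi_1(X,x_0)\to\pi_1(Y,y_0)$ for any map $f\colon (X,x_0)\to (Y,y_0)$ to a pointed semilocally simply connected space; (d) the kernel of the natural homomorphism $\pi_1(X,x_0)\to\check\pi_1(X,x_0)$ from the fundamental group to the Čech fundamental group.
   Context: For an open cover $\mathcal U$ of $X$ and $x_1\in X$, $\pi(\mathcal U,x_1)$ is the subgroup of $\pi_1(X,x_1)$ generated by all $[\alpha\ast\gamma\ast\alpha^{-1}]$, where $\gamma$ is a loop in some $U\in\mathcal U$ and $\alpha$ is a path in $X$ from $x_1$ to $\gamma(0)$. Let $\widetilde X$ be the set of homotopy classes rel. endpoints $[\alpha]$ of paths $\alpha$ in $X$ with $\alpha(0)=x_0$. It carries the topology with basis the sets $B([\alpha],\mathcal U,V)$, where $\mathcal U$ is an open cover of $X$, $\alpha$ is a path originating at $x_0$, $V\in\mathcal U$ contains $\alpha(1)$, and $[\beta]\in B([\alpha],\mathcal U,V)$ iff there are a path $\gamma_0$ in $V$ originating at $\alpha(1)$ and a loop $\lambda$ at $\alpha(1)$ with $[\lambda]\in\pi(\mathcal U,\alpha(1))$ and $[\beta]=[\alpha\ast\lambda\ast\gamma_0]$. The group $\pi_1(X,x_0)$,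 being the fiber over $x_0$ of the endpoint projection $\widetilde X\to X$, is topologized as a subspace of $\widetilde X$; "closed" refers to this topology. The Čech fundamental group $\check\pi_1(X,x_0)$ is, as in shape theory, the inverse limit of the inverse system $\{\pi_1(K_s,k_s)\}_{s\in S}$ of fundamental groups of pointed simplicial complexes in the Čech system (pointed polyhedral expansion) of $(X,x_0)$, which comes with maps $f_s\colon(X,x_0)\to(K_s,k_s)$ such that for $t>s$ the map $f_s$ is homotopic to the composition of $f_t$ with the bonding map $(K_t,k_t)\to(K_s,k_s)$; the natural homomorphism $\pi_1(X,x_0)\to\check\pi_1(X,x_0)$ is induced by the homomorphisms $\pi_1(f_s)$. *)

theory Defs
  imports "HOL-Analysis.Analysis" "HOL-Algebra.Generated_Groups" "HOL-Algebra.Product_Groups"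
begin

section \<open>Paths and the fundamental group of an abstract topology\<close>

text \<open>
  Paths are functions on the reals that are continuous on the unit interval (\<^const>\<open>pathin\<close>);
  their values elsewhere are irrelevant.  The library's \<^const>\<open>joinpaths\<close>,
  \<^const>\<open>reversepath\<close> and \<^const>\<open>homotopic_paths\<close> live in the class of topological spaces,
  so the same notions are spelled out here for arbitrary types.
\<close>

definition path_join :: "(real \<Rightarrow> 'a) \<Rightarrow> (real \<Rightarrow> 'a) \<Rightarrow> real \<Rightarrow> 'a" where
  "path_join p q = (\<lambda>t. if t \<le> 1/2 then p (2 * t) else q (2 * t - 1))"

definition path_reverse :: "(real \<Rightarrow> 'a) \<Rightarrow> real \<Rightarrow> 'a" where
  "path_reverse p = (\<lambda>t. p (1 - t))"

definition path_homotopic :: "'a topology \<Rightarrow> (real \<Rightarrow> 'a) \<Rightarrow> (real \<Rightarrow> 'a) \<Rightarrow> bool" where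
  "path_homotopic X p q \<longleftrightarrow>
     homotopic_with (\<lambda>r. r 0 = p 0 \<and> r 1 = p 1) (top_of_set {0..1}) X p q"

definition path_class :: "'a topology \<Rightarrow> (real \<Rightarrow> 'a) \<Rightarrow> (real \<Rightarrow> 'a) set" where
  "path_class X p = {q. path_homotopic X p q}"

definition loop_at :: "'a topology \<Rightarrow> 'a \<Rightarrow> (real \<Rightarrow> 'a) \<Rightarrow> bool" where
  "loop_at X x p \<longleftrightarrow> pathin X p \<and> p 0 = x \<and> p 1 = x"

definition fundamental_group :: "'a topology \<Rightarrow> 'a \<Rightarrow> (real \<Rightarrow> 'a) set monoid" where
  "fundamental_group X x =
     \<lparr>carrier = path_class X ` {p. loop_at X x p},
      monoid.mult = (\<lambda>A B. \<Union>p\<in>A. \<Union>q\<in>B. path_class X (path_join p q)),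
      one = path_class X (\<lambda>t. x)\<rparr>"

text \<open>The homomorphism induced by a map \<open>f\<close> into \<open>Y\<close>, sending the class of \<open>p\<close> to that of
  \<open>f \<circ> p\<close>.\<close>

definition induced_map ::
    "'b topology \<Rightarrow> ('a \<Rightarrow> 'b) \<Rightarrow> (real \<Rightarrow> 'a) set \<Rightarrow> (real \<Rightarrow> 'b) set" where
  "induced_map Y f A = (\<Union>p\<in>A. path_class Y (f \<circ> p))"

text \<open>The condition concerns all loops in \<open>U\<close>, whatever their base point, and not only those based
  at \<open>y\<close>.  The two versions differ when \<open>Y\<close> is not locally path connected.\<close>

definition semilocally_simply_connected :: "'a topology \<Rightarrow> bool" where
  "semilocally_simply_connected Y \<longleftrightarrow>
     (\<forall>y \<in> topspace Y. \<exists>U. openin Y U \<and> y \<in> U \<and>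
        (\<forall>z p. loop_at (subtopology Y U) z p \<longrightarrow> path_homotopic Y p (\<lambda>t. z)))"

section \<open>The groups of an open cover and the topology on path classes\<close>

definition open_cover :: "'a topology \<Rightarrow> 'a set set \<Rightarrow> bool" where
  "open_cover X \<U> \<longleftrightarrow> (\<forall>U\<in>\<U>. openin X U) \<and> \<Union>\<U> = topspace X"

definition cover_group :: "'a topology \<Rightarrow> 'a set set \<Rightarrow> 'a \<Rightarrow> (real \<Rightarrow> 'a) set set" where
  "cover_group X \<U> x = generate (fundamental_group X x)
     {path_class X (path_join \<alpha> (path_join \<gamma> (path_reverse \<alpha>))) | \<alpha> \<gamma>.
        pathin X \<alpha> \<and> \<alpha> 0 = x \<and>
        (\<exists>U\<in>\<U>. loop_at (subtopology X U) (\<alpha> 1) \<gamma>)}"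

definition basic_nhd ::
    "'a topology \<Rightarrow> (real \<Rightarrow> 'a) \<Rightarrow> 'a set set \<Rightarrow> 'a set \<Rightarrow> (real \<Rightarrow> 'a) set set" where
  "basic_nhd X \<alpha> \<U> V =
     {path_class X (path_join \<alpha> (path_join \<delta> \<gamma>)) | \<delta> \<gamma>.
        loop_at X (\<alpha> 1) \<delta> \<and> path_class X \<delta> \<in> cover_group X \<U> (\<alpha> 1) \<and>
        pathin (subtopology X V) \<gamma> \<and> \<gamma> 0 = \<alpha> 1}"

text \<open>The sets \<^const>\<open>basic_nhd\<close> form a basis of a topology on the set of classes of paths starting
  at \<open>x\<close> (the cover by the whole space shows that they exhaust it), so the topology having them as a
  basis is the one that they generate.\<close>

definition path_classes_topology :: "'a topology \<Rightarrow> 'a \<Rightarrow> (real \<Rightarrow> 'a) set topology" where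
  "path_classes_topology X x = topology_generated_by
     {basic_nhd X \<alpha> \<U> V | \<alpha> \<U> V.
        pathin X \<alpha> \<and> \<alpha> 0 = x \<and> open_cover X \<U> \<and> V \<in> \<U> \<and> \<alpha> 1 \<in> V}"

definition fundamental_group_topology :: "'a topology \<Rightarrow> 'a \<Rightarrow> (real \<Rightarrow> 'a) set topology" where
  "fundamental_group_topology X x =
     subtopology (path_classes_topology X x) (carrier (fundamental_group X x))"

section \<open>Geometric realization of abstract simplicial complexes\<close>

text \<open>A complex is given by its set of (finite nonempty) simplices, and a point of its realization by
  its barycentric coordinates.\<close>

definition realization :: "'v set set \<Rightarrow> ('v \<Rightarrow> real) set" where
  "realization K =
     {b. (\<forall>v. 0 \<le> b v) \<and> {v. b v \<noteq> 0} \<in> K \<and> (\<Sum>v | b v \<noteq> 0. b v) = 1}"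

definition closed_simplex :: "'v set set \<Rightarrow> 'v set \<Rightarrow> ('v \<Rightarrow> real) set" where
  "closed_simplex K \<sigma> = {b \<in> realization K. {v. b v \<noteq> 0} \<subseteq> \<sigma>}"

text \<open>The weak topology: a set is open iff its trace on each closed simplex is open there.  The
  topology on the function type is the product topology, which induces the Euclidean topology on a
  closed simplex.\<close>

definition weak_topology :: "'v set set \<Rightarrow> ('v \<Rightarrow> real) topology" where
  "weak_topology K = topology (\<lambda>W. W \<subseteq> realization K \<and>
     (\<forall>\<sigma>\<in>K. openin (top_of_set (closed_simplex K \<sigma>)) (W \<inter> closed_simplex K \<sigma>)))"

lemma openin_weak_topology:
  "openin (weak_topology K) W \<longleftrightarrow> W \<subseteq> realization K \<and>
     (\<forall>\<sigma>\<in>K. openin (top_of_set (closed_simplex K \<sigma>)) (W \<inter> closed_simplex K \<sigma>))"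
proof -
  let ?P = "\<lambda>W. W \<subseteq> realization K \<and>
     (\<forall>\<sigma>\<in>K. openin (top_of_set (closed_simplex K \<sigma>)) (W \<inter> closed_simplex K \<sigma>))"
  have "?P (S \<inter> T)" if "?P S" "?P T" for S T
  proof -
    have "S \<inter> T \<inter> C = (S \<inter> C) \<inter> (T \<inter> C)" for C by blast
    with that show ?thesis by (metis openin_Int le_infI1)
  qed
  moreover have "?P (\<Union>\<W>)" if "\<forall>W\<in>\<W>. ?P W" for \<W>
  proof -
    have eq: "\<Union>\<W> \<inter> C = \<Union>((\<lambda>W. W \<inter> C) ` \<W>)" for C by blast
    have "openin (top_of_set (closed_simplex K \<sigma>)) (\<Union>\<W> \<inter> closed_simplex K \<sigma>)" if "\<sigma> \<in> K" for \<sigma>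
      unfolding eq by (rule openin_Union) (use \<open>\<forall>W\<in>\<W>. ?P W\<close> \<open>\<sigma> \<in> K\<close> in blast)
    with that show ?thesis by blast
  qed
  ultimately have "istopology ?P"
    unfolding istopology_def by blast
  then show ?thesis
    by (simp add: weak_topology_def topology_inverse')
qed

lemma topspace_weak_topology: "topspace (weak_topology K) = realization K"
proof -
  have "realization K \<inter> closed_simplex K \<sigma> = closed_simplex K \<sigma>" for \<sigma>
    by (auto simp: closed_simplex_def)
  then have "openin (weak_topology K) (realization K)"
    by (simp add: openin_weak_topology)
  then show ?thesis
    by (metis openin_weak_topology openin_subset openin_topspace subset_antisym)
qed

definition vertex_point :: "'v \<Rightarrow> 'v \<Rightarrow> real" where
  "vertex_point v = (\<lambda>w. if w = v then 1 else 0)"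

text \<open>The affine extension of a vertex map.\<close>

definition simplicial_map :: "('v \<Rightarrow> 'w) \<Rightarrow> ('v \<Rightarrow> real) \<Rightarrow> 'w \<Rightarrow> real" where
  "simplicial_map r b = (\<lambda>w. \<Sum>v | b v \<noteq> 0 \<and> r v = w. b v)"

definition nerve :: "'a set set \<Rightarrow> 'a set set set" where
  "nerve \<U> = {\<sigma>. finite \<sigma> \<and> \<sigma> \<noteq> {} \<and> \<sigma> \<subseteq> \<U> \<and> \<Inter>\<sigma> \<noteq> {}}"

section \<open>The Cech system of a pointed space\<close>

text \<open>
  The index set consists of the normal open covers of \<open>X\<close> with a distinguished member \<open>U0\<close>
  containing the base point, where the cover admits a locally finite subordinate partition of unity
  \<open>\<phi>\<close> with \<open>\<phi> U0 x = 1\<close>.  On a paracompact Hausdorff space, such covers are cofinal among the open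
  covers with a distinguished member containing the base point.
\<close>

definition pointed_partition_of_unity ::
    "'a topology \<Rightarrow> 'a \<Rightarrow> 'a set set \<times> 'a set \<Rightarrow> ('a set \<Rightarrow> 'a \<Rightarrow> real) \<Rightarrow> bool" where
  "pointed_partition_of_unity X x0 = (\<lambda>(\<U>, U0) \<phi>.
     (\<forall>U\<in>\<U>. continuous_map X euclideanreal (\<phi> U)) \<and>
     (\<forall>U\<in>\<U>. \<forall>x\<in>topspace X. 0 \<le> \<phi> U x \<and> (\<phi> U x \<noteq> 0 \<longrightarrow> x \<in> U)) \<and>
     (\<forall>x\<in>topspace X. \<exists>N. openin X N \<and> x \<in> N \<and> finite {U\<in>\<U>. \<exists>y\<in>N. \<phi> U y \<noteq> 0}) \<and>
     (\<forall>x\<in>topspace X. (\<Sum>U\<in>{U\<in>\<U>. \<phi> U x \<noteq> 0}. \<phi> U x) = 1) \<and>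
     \<phi> U0 x0 = 1)"

definition cech_index :: "'a topology \<Rightarrow> 'a \<Rightarrow> ('a set set \<times> 'a set) set" where
  "cech_index X x0 = {(\<U>, U0). open_cover X \<U> \<and> U0 \<in> \<U> \<and> x0 \<in> U0 \<and>
     (\<exists>\<phi>. pointed_partition_of_unity X x0 (\<U>, U0) \<phi>)}"

definition cech_refines :: "'a set set \<times> 'a set \<Rightarrow> 'a set set \<times> 'a set \<Rightarrow> bool" where
  "cech_refines t s \<longleftrightarrow> (\<forall>V\<in>fst t. \<exists>U\<in>fst s. V \<subseteq> U) \<and> snd t \<subseteq> snd s"

definition cech_space :: "'a set set \<times> 'a set \<Rightarrow> ('a set \<Rightarrow> real) topology" where
  "cech_space s = weak_topology (nerve (fst s))"

definition cech_point :: "'a set set \<times> 'a set \<Rightarrow> 'a set \<Rightarrow> real" where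
  "cech_point s = vertex_point (snd s)"

text \<open>Bonding maps and the maps from \<open>X\<close> to the nerves depend on choices (unique up to pointed
  homotopy): \<open>r s t\<close> is a pointed refinement projection from the cover \<open>t\<close> to the cover \<open>s\<close>, and
  \<open>\<phi> s\<close> is a partition of unity for \<open>s\<close>.\<close>

definition cech_choices ::
    "'a topology \<Rightarrow> 'a
     \<Rightarrow> ('a set set \<times> 'a set \<Rightarrow> 'a set set \<times> 'a set \<Rightarrow> 'a set \<Rightarrow> 'a set)
     \<Rightarrow> ('a set set \<times> 'a set \<Rightarrow> 'a set \<Rightarrow> 'a \<Rightarrow> real) \<Rightarrow> bool" where
  "cech_choices X x0 r \<phi> \<longleftrightarrow>
     (\<forall>s\<in>cech_index X x0. \<forall>t\<in>cech_index X x0. cech_refines t s \<longrightarrow>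
        (\<forall>V\<in>fst t. r s t V \<in> fst s \<and> V \<subseteq> r s t V) \<and> r s t (snd t) = snd s) \<and>
     (\<forall>s\<in>cech_index X x0. pointed_partition_of_unity X x0 s (\<phi> s))"

definition cech_group ::
    "'a topology \<Rightarrow> 'a
     \<Rightarrow> ('a set set \<times> 'a set \<Rightarrow> 'a set set \<times> 'a set \<Rightarrow> 'a set \<Rightarrow> 'a set)
     \<Rightarrow> ('a set set \<times> 'a set \<Rightarrow> (real \<Rightarrow> 'a set \<Rightarrow> real) set) monoid" where
  "cech_group X x0 r =
     (let P = product_group (cech_index X x0)
                (\<lambda>s. fundamental_group (cech_space s) (cech_point s))
      in P\<lparr>carrier := {g \<in> carrier P. \<forall>s\<in>cech_index X x0. \<forall>t\<in>cech_index X x0.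
             cech_refines t s \<longrightarrow>
               induced_map (cech_space s) (simplicial_map (r s t)) (g t) = g s}\<rparr>)"

definition nerve_map :: "'a set set \<Rightarrow> ('a set \<Rightarrow> 'a \<Rightarrow> real) \<Rightarrow> 'a \<Rightarrow> 'a set \<Rightarrow> real" where
  "nerve_map \<U> \<phi> x = (\<lambda>U. if U \<in> \<U> then \<phi> U x else 0)"

definition natural_map ::
    "'a topology \<Rightarrow> 'a \<Rightarrow> ('a set set \<times> 'a set \<Rightarrow> 'a set \<Rightarrow> 'a \<Rightarrow> real)
     \<Rightarrow> (real \<Rightarrow> 'a) set \<Rightarrow> 'a set set \<times> 'a set \<Rightarrow> (real \<Rightarrow> 'a set \<Rightarrow> real) set" where
  "natural_map X x0 \<phi> A =
     (\<lambda>s\<in>cech_index X x0. induced_map (cech_space s) (nerve_map (fst s) (\<phi> s)) A)"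

end

theory Submission
  imports Defs
begin

text \<open>
  Everything follows from the first claim, and that one is a statement about cosets.  If \<open>\<alpha>\<close> is a loop
  at \<open>x\<close> and \<open>V\<close> is a member of \<open>\<U>\<close> around \<open>x\<close>, then an element of the basic neighbourhood of
  \<open>[\<alpha>]\<close> given by \<open>\<U>\<close> and \<open>V\<close> that lies in the fundamental group has the form \<open>[\<alpha>][\<lambda>][\<gamma>]\<close>, where
  \<open>[\<lambda>]\<close> is in the group of \<open>\<U>\<close> and \<open>\<gamma>\<close> is a loop in \<open>V\<close>, whose class is also in that group.  So the
  neighbourhood meets the fundamental group inside a left coset of the group of \<open>\<U>\<close>
  (\<open>basic_nhd_coset\<close>).  A subgroup \<open>H\<close> that contains the group of \<open>\<U>\<close> is a union of such cosets, and
  so is its complement, which is therefore open (\<open>closedin_subgroup_if_cover_group_subset\<close>).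
  Intersections of groups of covers are then closed as well.

  For a kernel it suffices to find an open cover of \<open>X\<close> such that the map sends each loop in a member
  to a null-homotopic loop: the kernel then contains the generators of the group of that cover
  (\<open>closedin_kernel_induced_map\<close>).  If the target is semilocally simply connected, the cover consists
  of preimages.  The kernel of the homomorphism to the Cech group is the intersection of the kernels
  of the homomorphisms induced by the maps to the nerves.  For such a map the cover consists of the
  preimages of the open stars of the vertices: an open star contracts to its vertex along straight
  segments.  The weak topology makes continuity of that contraction the delicate point; the local
  finiteness of the partition of unity reduces it to finitely many simplices
  (\<open>continuous_map_weak_topology\<close>).  The contraction moves the base point of a loop, so it is a
  free homotopy, and \<open>path_homotopic_const_if_freely_null\<close> turns it into one rel endpoints.
\<close>

section \<open>Path homotopies\<close>

abbreviation unit_square :: "(real \<times> real) topology" where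
  "unit_square \<equiv> prod_topology (top_of_set {0..1}) (top_of_set {0..1})"

lemma path_homotopic_iff:
  "path_homotopic X p q \<longleftrightarrow>
     (\<exists>h. continuous_map unit_square X h \<and>
        (\<forall>s\<in>{0..1}. h (0, s) = p s) \<and> (\<forall>s\<in>{0..1}. h (1, s) = q s) \<and>
        (\<forall>t\<in>{0..1}. h (t, 0) = p 0 \<and> h (t, 1) = p 1))"
  unfolding path_homotopic_def by (subst homotopic_with) auto

lemma path_homotopicD:
  assumes "path_homotopic X p q"
  shows "pathin X p" "pathin X q" "q 0 = p 0" "q 1 = p 1"
  using homotopic_with_imp_continuous_maps[OF assms[unfolded path_homotopic_def]]
    homotopic_with_imp_property[OF assms[unfolded path_homotopic_def]]
  by (auto simp: pathin_def)

lemma path_homotopic_sym: "path_homotopic X p q \<Longrightarrow> path_homotopic X q p"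
  using path_homotopicD(3,4)[of X p q] homotopic_with_symD
  unfolding path_homotopic_def by fastforce

lemma path_homotopic_trans [trans]:
  assumes "path_homotopic X p q" "path_homotopic X q r"
  shows "path_homotopic X p r"
proof -
  have "homotopic_with (\<lambda>r. r 0 = p 0 \<and> r 1 = p 1) (top_of_set {0..1}) X q r"
    using assms(2) path_homotopicD(3,4)[OF assms(1)] by (simp add: path_homotopic_def)
  with assms(1) show ?thesis
    unfolding path_homotopic_def by (rule homotopic_with_trans)
qed

lemma path_homotopic_eq:
  assumes "pathin X p" "\<And>t. t \<in> {0..1} \<Longrightarrow> q t = p t"
  shows "path_homotopic X p q"
  unfolding path_homotopic_def
  by (rule homotopic_with_equal) (use assms in \<open>auto simp: pathin_def\<close>)

lemma path_homotopic_refl: "pathin X p \<Longrightarrow> path_homotopic X p p"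
  by (rule path_homotopic_eq) auto

lemma path_homotopic_compose:
  assumes "path_homotopic X p q" "continuous_map X Y f"
  shows "path_homotopic Y (f \<circ> p) (f \<circ> q)"
proof -
  obtain h where "continuous_map unit_square X h"
    "\<forall>s\<in>{0..1}. h (0, s) = p s" "\<forall>s\<in>{0..1}. h (1, s) = q s"
    "\<forall>t\<in>{0..1}. h (t, 0) = p 0 \<and> h (t, 1) = p 1"
    using assms(1) unfolding path_homotopic_iff by blast
  then show ?thesis
    unfolding path_homotopic_iff
    by (intro exI[of _ "f \<circ> h"]) (auto intro: continuous_map_compose assms(2))
qed

text \<open>A convex set has only one homotopy class of paths between any two points, and a continuous map
  preserves that.  Applied with the unit interval as the convex set, this covers every
  reparametrization and hence the groupoid laws; applied with the unit square, it turns a free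
  homotopy into one rel endpoints.\<close>

lemma path_homotopic_through_convex:
  fixes C :: "'c::real_normed_vector set"
  assumes "convex C" "continuous_map (top_of_set C) X F"
    and "pathin (top_of_set C) u" "pathin (top_of_set C) v" "u 0 = v 0" "u 1 = v 1"
  shows "path_homotopic X (F \<circ> u) (F \<circ> v)"
proof -
  let ?h = "\<lambda>z. (1 - fst z) *\<^sub>R u (snd z) + fst z *\<^sub>R v (snd z)"
  have u: "continuous_on {0..1} u" "u ` {0..1} \<subseteq> C" and v: "continuous_on {0..1} v" "v ` {0..1} \<subseteq> C"
    using assms(3,4) by (auto simp: pathin_def image_subset_iff_funcset)
  have "continuous_on ({0..1} \<times> {0..1}) ?h"
    by (intro continuous_intros continuous_on_compose2[OF u(1)] continuous_on_compose2[OF v(1)]) auto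
  moreover have "?h z \<in> C" if "z \<in> {0..1} \<times> {0..1}" for z
    by (intro convexD[OF assms(1)]) (use that u(2) v(2) in auto)
  ultimately have "continuous_map unit_square (top_of_set C) ?h"
    by (auto simp: continuous_map_in_subtopology)
  then have "path_homotopic (top_of_set C) u v"
    unfolding path_homotopic_iff
    by (intro exI[of _ ?h]) (auto simp: assms(5,6) simp flip: scaleR_add_left)
  then show ?thesis
    using assms(2) by (rule path_homotopic_compose)
qed

lemma path_homotopic_reparametrize:
  assumes "pathin X p"
    and "continuous_on {0..1} u" "u ` {0..1} \<subseteq> {0..1}"
    and "continuous_on {0..1} v" "v ` {0..1} \<subseteq> {0..1}"
    and "u 0 = v 0" "u 1 = v (1::real)"
  shows "path_homotopic X (p \<circ> u) (p \<circ> v)"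
  by (rule path_homotopic_through_convex[of "{0..1}"])
    (use assms in \<open>auto simp: pathin_def\<close>)

text \<open>Push the left edge of the square over the other three edges.  Along the top and the bottom edge
  \<open>F\<close> runs through the same values in opposite directions, and along the right edge it is constant.
  So under \<open>F\<close> the pushed path becomes the same path in \<open>X\<close> as one
  that runs out and back along the bottom edge, which is a null-homotopic loop in the square.\<close>

lemma path_homotopic_const_if_freely_null:
  assumes F: "continuous_map unit_square X F"
    and p: "\<And>s. s \<in> {0..1} \<Longrightarrow> F (0, s) = p s"
    and c: "\<And>s. s \<in> {0..1} \<Longrightarrow> F (1, s) = c"
    and ends: "\<And>t. t \<in> {0..1} \<Longrightarrow> F (t, 0) = F (t, 1)"
  shows "path_homotopic X p (\<lambda>t. p 0)"
proof -
  let ?C = "{0..1} \<times> {0..1} :: (real \<times> real) set"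
  have F': "continuous_map (top_of_set ?C) X F" using F by simp
  \<comment> \<open>The path \<open>(a, w)\<close> follows the bottom, the right and the top edge in one third of the time each.\<close>
  define a w :: "real \<Rightarrow> real"
    where "a s = max 0 (min 1 (min (3 * s) (3 - 3 * s)))" and "w s = max 0 (min 1 (3 * s - 1))" for s
  have aw: "continuous_on {0..1} a" "continuous_on {0..1} w"
    unfolding a_def w_def by (intro continuous_intros)+
  have path: "pathin (top_of_set ?C) g \<longleftrightarrow> continuous_on {0..1} g \<and> g ` {0..1} \<subseteq> ?C" for g
    by (auto simp: pathin_def image_subset_iff_funcset)
  note rules = path_homotopic_through_convex[OF _ F']
  have conv: "convex ?C" by (intro convex_Times) auto
  have aw01: "a s \<in> {0..1}" "w s \<in> {0..1}" for s by (auto simp: a_def w_def)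
  have "pathin (top_of_set ?C) (\<lambda>s. (0, s))" by (auto simp: path intro!: continuous_intros)
  then have "pathin X (F \<circ> (\<lambda>s. (0, s)))" using F' by (rule pathin_compose)
  then have "path_homotopic X (F \<circ> (\<lambda>s. (0, s))) p"
    by (rule path_homotopic_eq) (simp add: p)
  then have "path_homotopic X p (F \<circ> (\<lambda>s. (0, s)))" by (rule path_homotopic_sym)
  also have "path_homotopic X (F \<circ> (\<lambda>s. (0, s))) (F \<circ> (\<lambda>s. (a s, w s)))"
    by (rule rules[OF conv]) (use aw aw01 in \<open>auto simp: path a_def w_def intro!: continuous_intros\<close>)
  also have "path_homotopic X (F \<circ> (\<lambda>s. (a s, w s))) (F \<circ> (\<lambda>s. (a s, 0)))"
  proof (rule path_homotopic_eq)
    have "pathin (top_of_set ?C) (\<lambda>s. (a s, w s))"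
      using aw aw01 by (auto simp: path intro!: continuous_intros)
    then show "pathin X (F \<circ> (\<lambda>s. (a s, w s)))" using F' by (rule pathin_compose)
    fix s :: real assume s: "s \<in> {0..1}"
    consider "s \<le> 1/3" | "1/3 \<le> s" "s \<le> 2/3" | "2/3 \<le> s" by linarith
    then consider "w s = 0" | "a s = 1" | "w s = 1"
      by cases (simp_all add: a_def w_def)
    then show "(F \<circ> (\<lambda>s. (a s, 0))) s = (F \<circ> (\<lambda>s. (a s, w s))) s"
      by cases (use c ends aw01 in auto)
  qed
  also have "path_homotopic X (F \<circ> (\<lambda>s. (a s, 0))) (F \<circ> (\<lambda>s. (0, 0)))"
    by (rule rules[OF conv]) (use aw aw01 in \<open>auto simp: path a_def intro!: continuous_intros\<close>)
  finally show ?thesis by (simp add: o_def p)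
qed

section \<open>Concatenation and the fundamental group\<close>

lemma pathin_join:
  assumes "pathin X p" "pathin X q" "p 1 = q 0"
  shows "pathin X (path_join p q)"
  unfolding pathin_def path_join_def
proof (rule continuous_map_cases_le)
  have sub: "continuous_map (subtopology (top_of_set {0..1}) {t \<in> topspace (top_of_set {0..1}). t \<le> 1/2}) (top_of_set {0..1}) (\<lambda>t::real. 2 * t)"
    "continuous_map (subtopology (top_of_set {0..1}) {t \<in> topspace (top_of_set {0..1}). 1/2 \<le> t}) (top_of_set {0..1::real}) (\<lambda>t. 2 * t - 1)"
    by (auto simp: subtopology_subtopology continuous_map_in_subtopology intro!: continuous_intros)
  show "continuous_map (subtopology (top_of_set {0..1}) {t \<in> topspace (top_of_set {0..1}). t \<le> 1/2}) X (\<lambda>t. p (2 * t))"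
    using continuous_map_compose[OF sub(1) assms(1)[unfolded pathin_def]] by (simp add: o_def)
  show "continuous_map (subtopology (top_of_set {0..1}) {t \<in> topspace (top_of_set {0..1}). 1/2 \<le> t}) X (\<lambda>t. q (2 * t - 1))"
    using continuous_map_compose[OF sub(2) assms(2)[unfolded pathin_def]] by (simp add: o_def)
  fix t :: real assume "t = 1/2"
  then have "2 * t = 1" by simp
  then show "p (2 * t) = q (2 * t - 1)" by (simp add: assms(3))
qed auto

lemma pathin_reverse:
  assumes "pathin X p" shows "pathin X (path_reverse p)"
proof -
  have "continuous_map (top_of_set {0..1}) (top_of_set {0..1::real}) (\<lambda>t. 1 - t)"
    by (auto simp: continuous_map_in_subtopology intro!: continuous_intros)
  from continuous_map_compose[OF this assms[unfolded pathin_def]] show ?thesis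
    by (simp add: pathin_def path_reverse_def o_def)
qed

lemma path_ends [simp]:
  "path_join p q 0 = p 0" "path_join p q 1 = q 1"
  "path_reverse p 0 = p 1" "path_reverse p 1 = p 0"
  by (auto simp: path_join_def path_reverse_def)

lemma compose_path_join: "f \<circ> path_join p q = path_join (f \<circ> p) (f \<circ> q)"
  and compose_path_reverse: "f \<circ> path_reverse p = path_reverse (f \<circ> p)"
  by (auto simp: path_join_def path_reverse_def)

lemma path_homotopic_join:
  assumes "path_homotopic X p p'" "path_homotopic X q q'" "p 1 = q 0"
  shows "path_homotopic X (path_join p q) (path_join p' q')"
proof -
  obtain h where h: "continuous_map unit_square X h"
    "\<forall>s\<in>{0..1}. h (0, s) = p s" "\<forall>s\<in>{0..1}. h (1, s) = p' s"
    "\<forall>t\<in>{0..1}. h (t, 0) = p 0 \<and> h (t, 1) = p 1"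
    using assms(1) unfolding path_homotopic_iff by blast
  obtain k where k: "continuous_map unit_square X k"
    "\<forall>s\<in>{0..1}. k (0, s) = q s" "\<forall>s\<in>{0..1}. k (1, s) = q' s"
    "\<forall>t\<in>{0..1}. k (t, 0) = q 0 \<and> k (t, 1) = q 1"
    using assms(2) unfolding path_homotopic_iff by blast
  let ?H = "\<lambda>z. if snd z \<le> 1/2 then h (fst z, 2 * snd z) else k (fst z, 2 * snd z - 1)"
  have "continuous_map unit_square X ?H"
  proof (rule continuous_map_cases_le)
    have sub: "continuous_map (subtopology unit_square {z \<in> topspace unit_square. snd z \<le> 1/2}) unit_square (\<lambda>z. (fst z, 2 * snd z))"
      "continuous_map (subtopology unit_square {z \<in> topspace unit_square. 1/2 \<le> snd z}) unit_square (\<lambda>z. (fst z, 2 * snd z - 1))"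
      by (auto simp: subtopology_subtopology continuous_map_in_subtopology
          intro!: continuous_on_Pair continuous_on_fst continuous_on_snd continuous_on_diff
            continuous_on_mult_left continuous_on_const continuous_on_id)
    show "continuous_map (subtopology unit_square {z \<in> topspace unit_square. snd z \<le> 1/2}) X (\<lambda>z. h (fst z, 2 * snd z))"
      using continuous_map_compose[OF sub(1) h(1)] by (simp add: o_def)
    show "continuous_map (subtopology unit_square {z \<in> topspace unit_square. 1/2 \<le> snd z}) X (\<lambda>z. k (fst z, 2 * snd z - 1))"
      using continuous_map_compose[OF sub(2) k(1)] by (simp add: o_def)
    show "continuous_map unit_square euclideanreal snd"
      by (auto intro: continuous_on_snd continuous_on_id)
    fix z :: "real \<times> real" assume z: "z \<in> topspace unit_square" "snd z = 1/2"
    then have "2 * snd z = 1" by simp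
    then show "h (fst z, 2 * snd z) = k (fst z, 2 * snd z - 1)"
      using h(4) k(4) assms(3) z(1) by auto
  qed auto
  then show ?thesis
    unfolding path_homotopic_iff
    by (intro exI[of _ ?H]) (use h k in \<open>auto simp: path_join_def\<close>)
qed

lemma path_homotopic_eq_reparametrize:
  assumes "pathin X p" "continuous_on {0..1} u" "u ` {0..1} \<subseteq> {0..1}" "u 0 = 0" "u 1 = 1"
    and "\<And>t. t \<in> {0..1} \<Longrightarrow> q t = p (u t)"
  shows "path_homotopic X q p"
proof -
  have *: "path_homotopic X (p \<circ> u) (p \<circ> (\<lambda>t. t))"
    by (rule path_homotopic_reparametrize) (use assms in \<open>auto intro: continuous_intros\<close>)
  have "path_homotopic X (p \<circ> u) q"
    using path_homotopicD(1)[OF *] by (rule path_homotopic_eq) (simp add: assms(6))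
  from path_homotopic_trans[OF path_homotopic_sym[OF this] *] show ?thesis
    by (simp add: o_def)
qed

lemma path_homotopic_const_join:
  assumes "pathin X p" "p 0 = x"
  shows "path_homotopic X (path_join (\<lambda>t. x) p) p"
proof (rule path_homotopic_eq_reparametrize[OF assms(1)])
  let ?u = "\<lambda>t::real. max 0 (2 * t - 1)"
  show "continuous_on {0..1} ?u" by (intro continuous_intros)
  show "path_join (\<lambda>t. x) p t = p (?u t)" for t
    using assms(2) by (cases "t \<le> 1/2") (simp_all add: path_join_def)
qed auto

lemma path_homotopic_join_const:
  assumes "pathin X p" "p 1 = x"
  shows "path_homotopic X (path_join p (\<lambda>t. x)) p"
proof (rule path_homotopic_eq_reparametrize[OF assms(1)])
  let ?u = "\<lambda>t::real. min 1 (2 * t)"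
  show "continuous_on {0..1} ?u" by (intro continuous_intros)
  show "path_join p (\<lambda>t. x) t = p (?u t)" for t
    using assms(2) by (cases "t \<le> 1/2") (simp_all add: path_join_def)
qed auto

lemma path_homotopic_join_reverse:
  assumes "pathin X p"
  shows "path_homotopic X (path_join p (path_reverse p)) (\<lambda>t. p 0)"
proof -
  let ?u = "\<lambda>t::real. min (2 * t) (2 - 2 * t)"
  have *: "path_homotopic X (p \<circ> ?u) (p \<circ> (\<lambda>t. 0))"
  proof (rule path_homotopic_reparametrize[OF assms])
    show "continuous_on {0..1} ?u" by (intro continuous_intros)
  qed (auto simp: min_def)
  have "path_homotopic X (p \<circ> ?u) (path_join p (path_reverse p))"
    using path_homotopicD(1)[OF *]
  proof (rule path_homotopic_eq)
    fix t :: real assume "t \<in> {0..1}"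
    have "1 - (2 * t - 1) = 2 - 2 * t" by simp
    then show "path_join p (path_reverse p) t = (p \<circ> ?u) t"
      unfolding path_join_def path_reverse_def o_def by (auto simp: min_def)
  qed
  from path_homotopic_trans[OF path_homotopic_sym[OF this] *] show ?thesis
    by (simp add: o_def)
qed

text \<open>The function \<open>u\<close> is the piecewise linear map that takes the subdivision of the unit
  interval by 1/4 and 1/2 to the one by 1/2 and 3/4; its slopes decrease, so it is a minimum.\<close>

lemma path_homotopic_join_assoc:
  assumes "pathin X p" "pathin X q" "pathin X r" "p 1 = q 0" "q 1 = r 0"
  shows "path_homotopic X (path_join (path_join p q) r) (path_join p (path_join q r))"
proof -
  define u :: "real \<Rightarrow> real" where "u t = min (2 * t) (min (t + 1/4) ((t + 1) / 2))" for t
  show ?thesis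
  proof (rule path_homotopic_eq_reparametrize[of _ _ u])
    show "continuous_on {0..1} u" unfolding u_def by (intro continuous_intros) auto
    show "pathin X (path_join p (path_join q r))" by (intro pathin_join) (use assms in auto)
    fix t :: real assume t: "t \<in> {0..1}"
    consider "t \<le> 1/4" | "1/4 < t" "t \<le> 1/2" | "t > 1/2" by linarith
    then show "path_join (path_join p q) r t = path_join p (path_join q r) (u t)"
    proof cases
      case 1
      then have "u t = 2 * t" by (auto simp: u_def min_def)
      with 1 show ?thesis by (simp add: path_join_def)
    next
      case 2
      then have "u t = t + 1/4" by (auto simp: u_def min_def)
      moreover have "2 * (2 * (t + 1/4) - 1) = 2 * (2 * t) - 1" by simp
      ultimately show ?thesis using 2 by (simp add: path_join_def)
    next
      case 3
      then have "u t = (t + 1) / 2" by (auto simp: u_def min_def)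
      then have u: "3/4 < u t" "2 * (2 * u t - 1) - 1 = 2 * t - 1" using 3 by auto
      have "path_join p (path_join q r) (u t) = r (2 * (2 * u t - 1) - 1)"
        using u(1) by (simp add: path_join_def)
      also note u(2)
      finally show ?thesis using 3 by (simp add: path_join_def)
    qed
  qed (auto simp: u_def min_def)
qed

lemma path_class_eq_iff:
  assumes "pathin X p"
  shows "path_class X p = path_class X q \<longleftrightarrow> path_homotopic X p q"
proof
  assume "path_class X p = path_class X q"
  with path_homotopic_refl[OF assms] show "path_homotopic X p q"
    by (auto simp: path_class_def intro: path_homotopic_sym)
next
  assume "path_homotopic X p q"
  then show "path_class X p = path_class X q"
    unfolding path_class_def by (blast intro: path_homotopic_trans path_homotopic_sym)
qed

lemma path_class_eqI: "path_homotopic X p q \<Longrightarrow> path_class X p = path_class X q"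
  using path_class_eq_iff path_homotopicD(1) by blast

lemma path_class_self: "pathin X p \<Longrightarrow> p \<in> path_class X p"
  by (simp add: path_class_def path_homotopic_refl)

lemma carrier_fundamental_group:
  "carrier (fundamental_group X x) = {path_class X p | p. loop_at X x p}"
  by (auto simp: fundamental_group_def)

lemma one_fundamental_group: "\<one>\<^bsub>fundamental_group X x\<^esub> = path_class X (\<lambda>t. x)"
  by (simp add: fundamental_group_def)

lemma path_class_in_carrier: "loop_at X x p \<Longrightarrow> path_class X p \<in> carrier (fundamental_group X x)"
  by (auto simp: carrier_fundamental_group)

lemma loop_at_join: "loop_at X x p \<Longrightarrow> loop_at X x q \<Longrightarrow> loop_at X x (path_join p q)"
  by (simp add: loop_at_def pathin_join)

lemma mult_path_class:
  assumes "loop_at X x p" "loop_at X x q"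
  shows "path_class X p \<otimes>\<^bsub>fundamental_group X x\<^esub> path_class X q = path_class X (path_join p q)"
proof -
  have "path_class X (path_join p' q') = path_class X (path_join p q)"
    if "p' \<in> path_class X p" "q' \<in> path_class X q" for p' q'
  proof -
    have "path_homotopic X (path_join p q) (path_join p' q')"
      using that assms by (intro path_homotopic_join) (auto simp: path_class_def loop_at_def)
    then show ?thesis
      by (metis path_class_eqI)
  qed
  moreover have "p \<in> path_class X p" "q \<in> path_class X q"
    using assms by (auto simp: loop_at_def path_class_self)
  ultimately have "(\<Union>p'\<in>path_class X p. \<Union>q'\<in>path_class X q. path_class X (path_join p' q'))
      = path_class X (path_join p q)"
    by blast
  then show ?thesis by (simp add: fundamental_group_def)
qed

lemma group_fundamental_group:
  assumes "x \<in> topspace X"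
  shows "group (fundamental_group X x)"
proof (rule groupI)
  let ?G = "fundamental_group X x"
  have const: "loop_at X x (\<lambda>t. x)" using assms by (simp add: loop_at_def)
  show "\<one>\<^bsub>?G\<^esub> \<in> carrier ?G"
    by (simp add: one_fundamental_group path_class_in_carrier const)
  fix A assume "A \<in> carrier ?G"
  then obtain p where p: "A = path_class X p" "loop_at X x p"
    by (auto simp: carrier_fundamental_group)
  have "path_homotopic X (path_join (\<lambda>t. x) p) p"
    using p(2) by (intro path_homotopic_const_join) (auto simp: loop_at_def)
  from path_class_eqI[OF this] show "\<one>\<^bsub>?G\<^esub> \<otimes>\<^bsub>?G\<^esub> A = A"
    using p by (simp add: one_fundamental_group mult_path_class const)
  have rev: "loop_at X x (path_reverse p)"
    using p(2) by (simp add: loop_at_def pathin_reverse)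
  have "path_reverse (path_reverse p) = p" by (simp add: path_reverse_def)
  then have "path_homotopic X (path_join (path_reverse p) p) (\<lambda>t. x)"
    using path_homotopic_join_reverse[of X "path_reverse p"] rev by (simp add: loop_at_def)
  from path_class_eqI[OF this] have "path_class X (path_reverse p) \<otimes>\<^bsub>?G\<^esub> A = \<one>\<^bsub>?G\<^esub>"
    unfolding p(1) one_fundamental_group mult_path_class[OF rev p(2)] .
  then show "\<exists>B\<in>carrier ?G. B \<otimes>\<^bsub>?G\<^esub> A = \<one>\<^bsub>?G\<^esub>"
    using path_class_in_carrier[OF rev] by (rule bexI)
  fix B assume "B \<in> carrier ?G"
  then obtain q where q: "B = path_class X q" "loop_at X x q"
    by (auto simp: carrier_fundamental_group)
  show "A \<otimes>\<^bsub>?G\<^esub> B \<in> carrier ?G"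
    using p q by (simp add: mult_path_class loop_at_join path_class_in_carrier)
  fix C assume "C \<in> carrier ?G"
  then obtain r where r: "C = path_class X r" "loop_at X x r"
    by (auto simp: carrier_fundamental_group)
  have "path_homotopic X (path_join (path_join p q) r) (path_join p (path_join q r))"
    using p q r by (intro path_homotopic_join_assoc) (auto simp: loop_at_def)
  from path_class_eqI[OF this] show "A \<otimes>\<^bsub>?G\<^esub> B \<otimes>\<^bsub>?G\<^esub> C = A \<otimes>\<^bsub>?G\<^esub> (B \<otimes>\<^bsub>?G\<^esub> C)"
    using p q r by (simp add: mult_path_class loop_at_join)
qed

lemma induced_map_path_class:
  assumes "pathin X p" "continuous_map X Y f"
  shows "induced_map Y f (path_class X p) = path_class Y (f \<circ> p)"
proof -
  have "path_class Y (f \<circ> q) = path_class Y (f \<circ> p)" if "q \<in> path_class X p" for q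
  proof -
    have "path_homotopic Y (f \<circ> p) (f \<circ> q)"
      using that assms(2) path_homotopic_compose by (auto simp: path_class_def)
    then show ?thesis by (metis path_class_eqI)
  qed
  with path_class_self[OF assms(1)] show ?thesis
    unfolding induced_map_def by blast
qed

lemma loop_at_compose:
  "loop_at X x p \<Longrightarrow> continuous_map X Y f \<Longrightarrow> loop_at Y (f x) (f \<circ> p)"
  using pathin_compose by (fastforce simp: loop_at_def)

lemma group_hom_induced_map:
  assumes "continuous_map X Y f" "x \<in> topspace X"
  shows "group_hom (fundamental_group X x) (fundamental_group Y (f x)) (induced_map Y f)"
proof (intro group_hom.intro group_hom_axioms.intro)
  show "group (fundamental_group X x)" "group (fundamental_group Y (f x))"
    using assms by (auto intro!: group_fundamental_group dest: continuous_map_funspace)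
  have image: "induced_map Y f (path_class X p) = path_class Y (f \<circ> p)" if "loop_at X x p" for p
    using that assms(1) by (simp add: loop_at_def induced_map_path_class)
  show "induced_map Y f \<in> hom (fundamental_group X x) (fundamental_group Y (f x))"
  proof (rule homI)
    fix A assume "A \<in> carrier (fundamental_group X x)"
    then obtain p where p: "A = path_class X p" "loop_at X x p"
      by (auto simp: carrier_fundamental_group)
    note fp = loop_at_compose[OF p(2) assms(1)]
    show "induced_map Y f A \<in> carrier (fundamental_group Y (f x))"
      unfolding p(1) image[OF p(2)] by (rule path_class_in_carrier[OF fp])
    fix B assume "B \<in> carrier (fundamental_group X x)"
    then obtain q where q: "B = path_class X q" "loop_at X x q"
      by (auto simp: carrier_fundamental_group)
    show "induced_map Y f (A \<otimes>\<^bsub>fundamental_group X x\<^esub> B)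
        = induced_map Y f A \<otimes>\<^bsub>fundamental_group Y (f x)\<^esub> induced_map Y f B"
      unfolding p(1) q(1) mult_path_class[OF p(2) q(2)] image[OF p(2)] image[OF q(2)]
        image[OF loop_at_join[OF p(2) q(2)]] compose_path_join
        mult_path_class[OF fp loop_at_compose[OF q(2) assms(1)]] ..
  qed
qed

section \<open>Subgroups that contain the group of a cover\<close>

lemma loop_at_conjugate:
  assumes "pathin X \<alpha>" "loop_at X (\<alpha> 1) \<gamma>"
  shows "loop_at X (\<alpha> 0) (path_join \<alpha> (path_join \<gamma> (path_reverse \<alpha>)))"
  using assms by (simp add: loop_at_def pathin_join pathin_reverse)

lemma loop_at_subtopology: "loop_at (subtopology X U) x p \<Longrightarrow> loop_at X x p"
  by (simp add: loop_at_def pathin_subtopology)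

lemma subgroup_cover_group:
  assumes "x \<in> topspace X"
  shows "subgroup (cover_group X \<U> x) (fundamental_group X x)"
  unfolding cover_group_def
proof (rule group.generate_is_subgroup[OF group_fundamental_group[OF assms]], rule subsetI)
  fix A
  assume "A \<in> {path_class X (path_join \<alpha> (path_join \<gamma> (path_reverse \<alpha>))) | \<alpha> \<gamma>.
    pathin X \<alpha> \<and> \<alpha> 0 = x \<and> (\<exists>U\<in>\<U>. loop_at (subtopology X U) (\<alpha> 1) \<gamma>)}"
  then obtain \<alpha> \<gamma> U where A: "A = path_class X (path_join \<alpha> (path_join \<gamma> (path_reverse \<alpha>)))"
    and \<alpha>: "pathin X \<alpha>" "\<alpha> 0 = x" and \<gamma>: "loop_at (subtopology X U) (\<alpha> 1) \<gamma>"
    by blast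
  show "A \<in> carrier (fundamental_group X x)"
    using path_class_in_carrier[OF loop_at_conjugate[OF \<alpha>(1) loop_at_subtopology[OF \<gamma>]]]
    unfolding A \<alpha>(2) .
qed

lemma cover_group_subset:
  assumes "x \<in> topspace X" "subgroup H (fundamental_group X x)"
    and gen: "\<And>U \<alpha> \<gamma>. U \<in> \<U> \<Longrightarrow> pathin X \<alpha> \<Longrightarrow> \<alpha> 0 = x \<Longrightarrow> loop_at (subtopology X U) (\<alpha> 1) \<gamma>
      \<Longrightarrow> path_class X (path_join \<alpha> (path_join \<gamma> (path_reverse \<alpha>))) \<in> H"
  shows "cover_group X \<U> x \<subseteq> H"
  unfolding cover_group_def
  by (rule group.generate_subgroup_incl[OF group_fundamental_group[OF assms(1)] _ assms(2)])
    (use gen in blast)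

text \<open>A loop based at \<open>x\<close> is the conjugate of itself by the constant path.\<close>

lemma cover_group_if_loop_in_member:
  assumes "U \<in> \<U>" "loop_at (subtopology X U) x \<gamma>"
  shows "path_class X \<gamma> \<in> cover_group X \<U> x"
proof -
  let ?c = "\<lambda>t::real. x"
  have \<gamma>: "pathin X \<gamma>" "\<gamma> 0 = x" "\<gamma> 1 = x" "x \<in> topspace X"
    using loop_at_subtopology[OF assms(2)] path_start_in_topspace[of X \<gamma>] by (auto simp: loop_at_def)
  have rev: "path_reverse ?c = ?c" by (simp add: path_reverse_def)
  have "path_homotopic X (path_join ?c (path_join \<gamma> ?c)) (path_join \<gamma> ?c)"
    by (rule path_homotopic_const_join) (simp_all add: \<gamma> pathin_join)
  also have "path_homotopic X (path_join \<gamma> ?c) \<gamma>"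
    by (rule path_homotopic_join_const) (simp_all add: \<gamma>)
  finally have "path_class X \<gamma> = path_class X (path_join ?c (path_join \<gamma> (path_reverse ?c)))"
    unfolding rev by (rule path_class_eqI[symmetric])
  moreover have "pathin X ?c" using \<gamma> by simp
  ultimately show ?thesis
    unfolding cover_group_def using assms by (intro generate.incl) fast
qed

lemma path_class_in_basic_nhd:
  assumes "pathin X \<alpha>" "\<alpha> 1 \<in> V"
  shows "path_class X \<alpha> \<in> basic_nhd X \<alpha> \<U> V"
proof -
  let ?c = "\<lambda>t::real. \<alpha> 1"
  have end_in: "\<alpha> 1 \<in> topspace X" using assms(1) by (rule path_finish_in_topspace)
  then have "path_class X ?c \<in> cover_group X \<U> (\<alpha> 1)"
    using subgroup.one_closed[OF subgroup_cover_group] by (metis one_fundamental_group)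
  moreover have "path_join ?c ?c = ?c" by (simp add: path_join_def)
  moreover have "path_class X (path_join \<alpha> ?c) = path_class X \<alpha>"
    by (intro path_class_eqI path_homotopic_join_const assms) simp
  ultimately show ?thesis
    unfolding basic_nhd_def using assms end_in
    by (intro CollectI exI[of _ ?c]) (auto simp: loop_at_def)
qed

lemma openin_basic_nhd:
  assumes "open_cover X \<U>" "V \<in> \<U>" "pathin X \<alpha>" "\<alpha> 0 = x" "\<alpha> 1 \<in> V"
  shows "openin (path_classes_topology X x) (basic_nhd X \<alpha> \<U> V)"
  unfolding path_classes_topology_def
  by (rule topology_generated_by_Basis) (use assms in blast)

lemma topspace_fundamental_group_topology:
  "topspace (fundamental_group_topology X x) = carrier (fundamental_group X x)"
proof -
  have "path_class X \<alpha> \<in> topspace (path_classes_topology X x)" if "loop_at X x \<alpha>" for \<alpha>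
  proof -
    have path: "pathin X \<alpha>" "\<alpha> 0 = x" using that by (auto simp: loop_at_def)
    note \<alpha> = path path_finish_in_topspace[OF path(1)]
    have "open_cover X {topspace X}" by (simp add: open_cover_def)
    then have "openin (path_classes_topology X x) (basic_nhd X \<alpha> {topspace X} (topspace X))"
      by (rule openin_basic_nhd) (use \<alpha> in auto)
    then show ?thesis
      using path_class_in_basic_nhd[OF \<alpha>(1) \<alpha>(3)] openin_subset by blast
  qed
  then show ?thesis
    by (auto simp: fundamental_group_topology_def carrier_fundamental_group)
qed

text \<open>This is the link between the topology and the group structure: on the fundamental group, the
  neighbourhoods given by \<open>\<U>\<close> do not leave the left cosets of the group of \<open>\<U>\<close>.\<close>

lemma basic_nhd_coset:
  assumes "loop_at X x \<alpha>" "V \<in> \<U>"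
    and "B \<in> basic_nhd X \<alpha> \<U> V" "B \<in> carrier (fundamental_group X x)"
  obtains C where "C \<in> cover_group X \<U> x" "B = path_class X \<alpha> \<otimes>\<^bsub>fundamental_group X x\<^esub> C"
proof -
  let ?G = "fundamental_group X x"
  have \<alpha>: "pathin X \<alpha>" "\<alpha> 0 = x" "\<alpha> 1 = x" using assms(1) by (auto simp: loop_at_def)
  obtain \<delta> \<gamma> where B: "B = path_class X (path_join \<alpha> (path_join \<delta> \<gamma>))"
    and \<delta>: "loop_at X x \<delta>" "path_class X \<delta> \<in> cover_group X \<U> x"
    and \<gamma>: "pathin (subtopology X V) \<gamma>" "\<gamma> 0 = x"
    using assms(3) unfolding basic_nhd_def \<alpha>(3) by blast
  obtain r where r: "B = path_class X r" "loop_at X x r"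
    using assms(4) by (auto simp: carrier_fundamental_group)
  \<comment> \<open>A class determines the endpoints of its paths, so \<open>\<gamma>\<close> is a loop as well.\<close>
  have "path_homotopic X r (path_join \<alpha> (path_join \<delta> \<gamma>))"
    using B r by (auto simp: loop_at_def simp flip: path_class_eq_iff)
  then have "\<gamma> 1 = x"
    using path_homotopicD(4) r(2) by (fastforce simp: loop_at_def)
  with \<gamma> have loop: "loop_at (subtopology X V) x \<gamma>" by (simp add: loop_at_def)
  note \<gamma>' = loop_at_subtopology[OF loop]
  have "x \<in> topspace X" using path_start_in_topspace[OF \<alpha>(1)] \<alpha>(2) by simp
  then have "path_class X \<delta> \<otimes>\<^bsub>?G\<^esub> path_class X \<gamma> \<in> cover_group X \<U> x"
    using \<delta>(2) cover_group_if_loop_in_member[OF assms(2) loop] subgroup_cover_group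
    by (metis subgroup.m_closed)
  moreover have "B = path_class X \<alpha> \<otimes>\<^bsub>?G\<^esub> (path_class X \<delta> \<otimes>\<^bsub>?G\<^esub> path_class X \<gamma>)"
    using B assms(1) \<delta>(1) \<gamma>' by (simp add: mult_path_class loop_at_join)
  ultimately show thesis by (rule that)
qed

text \<open>Left cosets of the group of \<open>\<U>\<close> do not cross from \<open>H\<close> to its complement, hence every point of
  the complement has a neighbourhood there.\<close>

theorem closedin_subgroup_if_cover_group_subset:
  assumes "x \<in> topspace X" "subgroup H (fundamental_group X x)"
    and "open_cover X \<U>" "cover_group X \<U> x \<subseteq> H"
  shows "closedin (fundamental_group_topology X x) H"
proof -
  let ?G = "fundamental_group X x" and ?T = "fundamental_group_topology X x"
  interpret group ?G using assms(1) by (rule group_fundamental_group)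
  interpret H: subgroup H ?G by (rule assms(2))
  obtain V where V: "V \<in> \<U>" "x \<in> V"
    using assms(1,3) by (auto simp: open_cover_def)
  have "\<exists>W. openin ?T W \<and> A \<in> W \<and> W \<subseteq> carrier ?G - H" if A: "A \<in> carrier ?G - H" for A
  proof -
    obtain \<alpha> where \<alpha>: "A = path_class X \<alpha>" "loop_at X x \<alpha>"
      using A by (auto simp: carrier_fundamental_group)
    let ?W = "carrier ?G \<inter> basic_nhd X \<alpha> \<U> V"
    have "openin ?T ?W"
      unfolding fundamental_group_topology_def
      by (intro openin_subtopology_Int2 openin_basic_nhd) (use \<alpha> V assms(3) in \<open>auto simp: loop_at_def\<close>)
    moreover have "A \<in> ?W"
      using A \<alpha> V path_class_in_basic_nhd[of X \<alpha> V] by (auto simp: loop_at_def)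
    moreover have "B \<notin> H" if B_nhd: "B \<in> basic_nhd X \<alpha> \<U> V" "B \<in> carrier ?G" for B
    proof
      assume "B \<in> H"
      obtain C where "C \<in> cover_group X \<U> x" and B: "B = A \<otimes>\<^bsub>?G\<^esub> C"
        unfolding \<alpha>(1) using basic_nhd_coset[OF \<alpha>(2) V(1) B_nhd] .
      then have C: "C \<in> H" using assms(4) by blast
      with A B have "A = B \<otimes>\<^bsub>?G\<^esub> inv\<^bsub>?G\<^esub> C" by (simp add: m_assoc)
      with A \<open>B \<in> H\<close> C show False by auto
    qed
    ultimately show ?thesis by (intro exI[of _ ?W]) auto
  qed
  then have "openin ?T (carrier ?G - H)"
    by (subst openin_subopen) blast
  then show ?thesis
    by (simp add: closedin_def topspace_fundamental_group_topology H.subset)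
qed

lemma closedin_topspace_Inter:
  assumes "\<And>i. i \<in> I \<Longrightarrow> closedin T (C i)"
  shows "closedin T (topspace T \<inter> (\<Inter>i\<in>I. C i))"
proof -
  have "closedin T (\<Inter>(insert (topspace T) (C ` I)))"
    by (rule closedin_Inter) (use assms in auto)
  then show ?thesis by simp
qed

section \<open>Kernels of induced homomorphisms\<close>

text \<open>The image of a conjugate \<open>\<alpha> * \<gamma> * \<alpha>\<inverse>\<close> is a conjugate of the image of \<open>\<gamma>\<close>, so it is trivial as soon
  as the latter is.  The null homotopies may use the whole of \<open>Y\<close>.\<close>

theorem closedin_kernel_induced_map:
  assumes "x \<in> topspace X" "continuous_map X Y f" "open_cover X \<U>"
    and null: "\<And>U z \<gamma>. U \<in> \<U> \<Longrightarrow> loop_at (subtopology X U) z \<gamma> \<Longrightarrow> path_homotopic Y (f \<circ> \<gamma>) (\<lambda>t. f z)"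
  shows "closedin (fundamental_group_topology X x)
    (kernel (fundamental_group X x) (fundamental_group Y (f x)) (induced_map Y f))"
proof (rule closedin_subgroup_if_cover_group_subset[OF assms(1) _ assms(3)])
  let ?G = "fundamental_group X x" and ?G' = "fundamental_group Y (f x)"
  let ?K = "kernel ?G ?G' (induced_map Y f)"
  interpret group_hom ?G ?G' "induced_map Y f"
    using assms(2,1) by (rule group_hom_induced_map)
  show "subgroup ?K ?G" by (rule subgroup_kernel)
  with assms(1) show "cover_group X \<U> x \<subseteq> ?K"
  proof (rule cover_group_subset)
    fix U \<alpha> \<gamma> assume \<alpha>: "pathin X \<alpha>" and x: "\<alpha> 0 = x"
      and \<gamma>: "U \<in> \<U>" "loop_at (subtopology X U) (\<alpha> 1) \<gamma>"
    let ?a = "f \<circ> \<alpha>" and ?p = "path_join \<alpha> (path_join \<gamma> (path_reverse \<alpha>))"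
    have a: "pathin Y ?a" "pathin Y (path_reverse ?a)"
      using \<alpha> assms(2) by (auto intro: pathin_compose pathin_reverse)
    have loop: "loop_at X x ?p"
      using loop_at_conjugate[OF \<alpha> loop_at_subtopology[OF \<gamma>(2)]] x by simp
    have "path_homotopic Y (path_join (f \<circ> \<gamma>) (path_reverse ?a))
        (path_join (\<lambda>t. f (\<alpha> 1)) (path_reverse ?a))"
      by (rule path_homotopic_join[OF null[OF \<gamma>] path_homotopic_refl[OF a(2)]])
        (use \<gamma>(2) in \<open>simp add: loop_at_def\<close>)
    also have "path_homotopic Y \<dots> (path_reverse ?a)"
      by (rule path_homotopic_const_join[OF a(2)]) simp
    finally have "path_homotopic Y (f \<circ> ?p) (path_join ?a (path_reverse ?a))"
      unfolding compose_path_join compose_path_reverse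
      by (rule path_homotopic_join[OF path_homotopic_refl[OF a(1)]])
        (use \<gamma>(2) in \<open>simp add: loop_at_def\<close>)
    also have "path_homotopic Y \<dots> (\<lambda>t. f x)"
      using path_homotopic_join_reverse[OF a(1)] x by simp
    finally have "path_class Y (f \<circ> ?p) = \<one>\<^bsub>?G'\<^esub>"
      unfolding one_fundamental_group by (rule path_class_eqI)
    then have "induced_map Y f (path_class X ?p) = \<one>\<^bsub>?G'\<^esub>"
      using loop assms(2) by (simp add: loop_at_def induced_map_path_class)
    then show "path_class X ?p \<in> ?K"
      using path_class_in_carrier[OF loop] by (simp add: kernel_def)
  qed
qed

lemma closedin_kernel_semilocally_simply_connected:
  assumes "x \<in> topspace X" "continuous_map X Y f" "semilocally_simply_connected Y"
  shows "closedin (fundamental_group_topology X x)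
    (kernel (fundamental_group X x) (fundamental_group Y (f x)) (induced_map Y f))"
proof (rule closedin_kernel_induced_map[OF assms(1,2)])
  define simple where
    "simple U \<longleftrightarrow> openin Y U \<and> (\<forall>z p. loop_at (subtopology Y U) z p \<longrightarrow> path_homotopic Y p (\<lambda>t. z))"
    for U
  define preimage where "preimage U = {z \<in> topspace X. f z \<in> U}" for U
  let ?\<U> = "preimage ` Collect simple"
  have cover: "\<exists>U. simple U \<and> y \<in> U" if "y \<in> topspace Y" for y
    using bspec[OF assms(3)[unfolded semilocally_simply_connected_def] that]
    unfolding simple_def by metis
  have "z \<in> \<Union>?\<U>" if z: "z \<in> topspace X" for z
  proof -
    have "f z \<in> topspace Y" using assms(2) z by (auto dest: continuous_map_funspace)
    then obtain U where "simple U" "f z \<in> U" using cover by blast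
    with z have "preimage U \<in> ?\<U>" "z \<in> preimage U" by (auto simp: preimage_def)
    then show ?thesis by (rule UnionI)
  qed
  moreover have "openin X (preimage U)" if "simple U" for U
    using that assms(2) unfolding simple_def preimage_def
    by (intro openin_continuous_map_preimage) auto
  moreover have "preimage U \<subseteq> topspace X" for U by (auto simp: preimage_def)
  ultimately show "open_cover X ?\<U>"
    unfolding open_cover_def by fast
  fix W z \<gamma> assume W: "W \<in> ?\<U>" and \<gamma>: "loop_at (subtopology X W) z \<gamma>"
  then obtain U where U: "simple U" "W = preimage U" by blast
  have "loop_at Y (f z) (f \<circ> \<gamma>)"
    using loop_at_compose[OF loop_at_subtopology[OF \<gamma>] assms(2)] .
  with \<gamma> U(2) have "loop_at (subtopology Y U) (f z) (f \<circ> \<gamma>)"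
    by (simp add: preimage_def loop_at_def pathin_subtopology)
  then show "path_homotopic Y (f \<circ> \<gamma>) (\<lambda>t. f z)"
    using U(1) unfolding simple_def by metis
qed

section \<open>Maps to nerves\<close>

lemma closedin_closed_simplex: "closedin (top_of_set (realization K)) (closed_simplex K \<sigma>)"
proof -
  have "closed {b :: 'a \<Rightarrow> real. b v = 0}" for v
    by (rule closed_Collect_eq) (auto intro: continuous_on_product_coordinates continuous_on_const)
  then have "closed (\<Inter>v\<in>-\<sigma>. {b :: 'a \<Rightarrow> real. b v = 0})" by auto
  moreover have "closed_simplex K \<sigma> = realization K \<inter> (\<Inter>v\<in>-\<sigma>. {b. b v = 0})"
    by (auto simp: closed_simplex_def)
  ultimately show ?thesis by (auto simp: closedin_closed)
qed

lemma closedin_weak_topology_Int_closed_simplex: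
  assumes "closedin (weak_topology K) C" "\<sigma> \<in> K"
  shows "closedin (top_of_set (realization K)) (C \<inter> closed_simplex K \<sigma>)"
proof -
  have "openin (top_of_set (closed_simplex K \<sigma>)) ((realization K - C) \<inter> closed_simplex K \<sigma>)"
    using assms by (simp add: closedin_def topspace_weak_topology openin_weak_topology)
  moreover have "(realization K - C) \<inter> closed_simplex K \<sigma> = closed_simplex K \<sigma> - C \<inter> closed_simplex K \<sigma>"
    by (auto simp: closed_simplex_def)
  ultimately have "closedin (top_of_set (closed_simplex K \<sigma>)) (C \<inter> closed_simplex K \<sigma>)"
    by (simp add: closedin_def)
  then show ?thesis using closedin_closed_simplex by (rule closedin_trans)
qed

text \<open>The image lies in a union of finitely many closed simplices, and a closed set of the weak
  topology meets each of them in a set that is closed for the product topology.  So the preimage of a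
  closed set is a finite union of closed sets, and continuity of the barycentric coordinates is
  enough.\<close>

lemma continuous_map_weak_topology_finite_support:
  assumes cont: "\<And>v. continuous_map Z euclideanreal (\<lambda>z. g z v)"
    and real: "g \<in> topspace Z \<rightarrow> realization K"
    and fin: "finite {v. \<exists>z\<in>topspace Z. g z v \<noteq> 0}" (is "finite ?F")
  shows "continuous_map Z (weak_topology K) g"
  unfolding continuous_map_closedin topspace_weak_topology
proof (intro conjI allI impI real)
  fix C assume C: "closedin (weak_topology K) C"
  have "continuous_map Z euclidean g"
    using cont by (simp add: continuous_map_componentwise_UNIV flip: euclidean_product_topology)
  then have g: "continuous_map Z (top_of_set (realization K)) g"
    using real by (rule continuous_map_into_subtopology)
  have "{z \<in> topspace Z. g z \<in> C}
      = (\<Union>\<sigma>\<in>{\<sigma>\<in>K. \<sigma> \<subseteq> ?F}. {z \<in> topspace Z. g z \<in> C \<inter> closed_simplex K \<sigma>})" (is "?L = ?R")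
  proof (intro subset_antisym subsetI)
    fix z assume z: "z \<in> ?L"
    let ?\<sigma> = "{v. g z v \<noteq> 0}"
    have "g z \<in> realization K" using z real by auto
    then have "?\<sigma> \<in> K" "g z \<in> closed_simplex K ?\<sigma>" by (auto simp: realization_def closed_simplex_def)
    moreover have "?\<sigma> \<subseteq> ?F" using z by auto
    ultimately show "z \<in> ?R" using z by blast
  qed auto
  moreover have "closedin Z ?R"
  proof (rule closedin_Union)
    show "finite ((\<lambda>\<sigma>. {z \<in> topspace Z. g z \<in> C \<inter> closed_simplex K \<sigma>}) ` {\<sigma>\<in>K. \<sigma> \<subseteq> ?F})"
      by (rule finite_imageI, rule finite_subset[of _ "Pow ?F"]) (use fin in auto)
    show "closedin Z S" if "S \<in> (\<lambda>\<sigma>. {z \<in> topspace Z. g z \<in> C \<inter> closed_simplex K \<sigma>}) ` {\<sigma>\<in>K. \<sigma> \<subseteq> ?F}" for S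
      using that closedin_continuous_map_preimage[OF g closedin_weak_topology_Int_closed_simplex[OF C]]
      by auto
  qed
  ultimately show "closedin Z {z \<in> topspace Z. g z \<in> C}" by simp
qed

lemma continuous_map_weak_topology:
  assumes cont: "\<And>v. continuous_map Z euclideanreal (\<lambda>z. g z v)"
    and real: "g \<in> topspace Z \<rightarrow> realization K"
    and fin: "\<And>z. z \<in> topspace Z \<Longrightarrow> \<exists>N. openin Z N \<and> z \<in> N \<and> finite {v. \<exists>y\<in>N. g y v \<noteq> 0}"
  shows "continuous_map Z (weak_topology K) g"
proof (rule pasting_lemma[where I = "{N. openin Z N \<and> finite {v. \<exists>y\<in>N. g y v \<noteq> 0}}"
    and T = "\<lambda>N. N" and f = "\<lambda>_. g"])
  fix N assume "N \<in> {N. openin Z N \<and> finite {v. \<exists>y\<in>N. g y v \<noteq> 0}}"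
  then have N: "openin Z N" "finite {v. \<exists>y\<in>N. g y v \<noteq> 0}" by auto
  show "openin Z N" by (rule N)
  have top: "topspace (subtopology Z N) = N"
    using openin_subset[OF N(1)] by (rule topspace_subtopology_subset)
  show "continuous_map (subtopology Z N) (weak_topology K) g"
  proof (rule continuous_map_weak_topology_finite_support)
    show "continuous_map (subtopology Z N) euclideanreal (\<lambda>z. g z v)" for v
      using cont by (rule continuous_map_from_subtopology)
    show "g \<in> topspace (subtopology Z N) \<rightarrow> realization K" using real by auto
    show "finite {v. \<exists>z\<in>topspace (subtopology Z N). g z v \<noteq> 0}" unfolding top by (rule N)
  qed
next
  fix z assume "z \<in> topspace Z"
  from fin[OF this] show "\<exists>N. N \<in> {N. openin Z N \<and> finite {v. \<exists>y\<in>N. g y v \<noteq> 0}} \<and> z \<in> N \<and> g z = g z"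
    by (elim exE conjE) (intro exI conjI CollectI refl)
qed simp

text \<open>The open star of a vertex \<open>U\<close> consists of the points with \<open>b U \<noteq> 0\<close>.  Moving such a point
  towards \<open>U\<close> adds no vertex to its support, so the segment stays in the simplex spanned by that
  support.\<close>

lemma segment_to_vertex_in_nerve:
  assumes b: "b \<in> realization (nerve \<U>)" and U: "b U \<noteq> 0" and t: "t \<in> {0..1}"
  shows "(\<lambda>V. (1 - t) * b V + t * vertex_point U V) \<in> realization (nerve \<U>)" (is "?c \<in> _")
proof -
  let ?S = "{V. b V \<noteq> 0}"
  have S: "finite ?S" "?S \<subseteq> \<U>" "\<Inter>?S \<noteq> {}" and nonneg: "\<And>V. 0 \<le> b V" and sum: "(\<Sum>V\<in>?S. b V) = 1"
    using b by (auto simp: realization_def nerve_def)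
  have sub: "{V. ?c V \<noteq> 0} \<subseteq> ?S"
    using U by (auto simp: vertex_point_def)
  have "0 < b U" using U nonneg[of U] by simp
  then have "?c U \<noteq> 0"
    using t by (cases "t = 0") (auto simp: vertex_point_def intro!: add_nonneg_pos less_imp_neq[symmetric])
  then have "{V. ?c V \<noteq> 0} \<noteq> {}" by blast
  moreover have "\<Inter>{V. ?c V \<noteq> 0} \<noteq> {}"
    using S(3) Inter_anti_mono[OF sub] by blast
  moreover have "(\<Sum>V | ?c V \<noteq> 0. ?c V) = 1"
  proof -
    have "(\<Sum>V | ?c V \<noteq> 0. ?c V) = (\<Sum>V\<in>?S. ?c V)"
      by (rule sum.mono_neutral_left[OF S(1) sub]) auto
    also have "\<dots> = (1 - t) * (\<Sum>V\<in>?S. b V) + t * (\<Sum>V\<in>?S. vertex_point U V)"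
      by (simp add: sum.distrib sum_distrib_left)
    also have "(\<Sum>V\<in>?S. vertex_point U V) = 1"
      using S(1) U by (simp add: vertex_point_def)
    finally show ?thesis by (simp add: sum)
  qed
  moreover have "0 \<le> ?c V" for V
    using t nonneg[of V] by (simp add: vertex_point_def)
  ultimately show ?thesis
    using S sub finite_subset[OF sub S(1)] by (auto simp: realization_def nerve_def)
qed

context
  fixes X :: "'a topology" and x0 :: 'a and \<U> :: "'a set set" and U0 :: "'a set" and \<phi>
  assumes part: "pointed_partition_of_unity X x0 (\<U>, U0) \<phi>"
begin

lemma
  shows continuous_map_partition: "U \<in> \<U> \<Longrightarrow> continuous_map X euclideanreal (\<phi> U)"
    and partition_nonneg: "U \<in> \<U> \<Longrightarrow> x \<in> topspace X \<Longrightarrow> 0 \<le> \<phi> U x"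
    and partition_support: "U \<in> \<U> \<Longrightarrow> x \<in> topspace X \<Longrightarrow> \<phi> U x \<noteq> 0 \<Longrightarrow> x \<in> U"
    and partition_locally_finite:
      "x \<in> topspace X \<Longrightarrow> \<exists>N. openin X N \<and> x \<in> N \<and> finite {U\<in>\<U>. \<exists>y\<in>N. \<phi> U y \<noteq> 0}"
    and partition_sum: "x \<in> topspace X \<Longrightarrow> (\<Sum>U\<in>{U\<in>\<U>. \<phi> U x \<noteq> 0}. \<phi> U x) = 1"
    and partition_base: "\<phi> U0 x0 = 1"
  using part unfolding pointed_partition_of_unity_def by auto

lemma partition_finite: "x \<in> topspace X \<Longrightarrow> finite {U\<in>\<U>. \<phi> U x \<noteq> 0}"
  using partition_locally_finite[of x] by (auto elim!: rev_finite_subset)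

lemma nerve_map_support: "{U. nerve_map \<U> \<phi> x U \<noteq> 0} = {U\<in>\<U>. \<phi> U x \<noteq> 0}"
  by (auto simp: nerve_map_def)

lemma nerve_map_in_realization:
  assumes "x \<in> topspace X"
  shows "nerve_map \<U> \<phi> x \<in> realization (nerve \<U>)"
proof -
  let ?S = "{U\<in>\<U>. \<phi> U x \<noteq> 0}"
  have "?S \<noteq> {}" using partition_sum[OF assms] by (metis sum.empty zero_neq_one)
  moreover have "x \<in> \<Inter>?S" using partition_support assms by auto
  ultimately have "?S \<in> nerve \<U>"
    using partition_finite[OF assms] by (auto simp: nerve_def)
  moreover have "(\<Sum>U\<in>?S. nerve_map \<U> \<phi> x U) = 1"
    using partition_sum[OF assms] by (simp add: nerve_map_def)
  ultimately show ?thesis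
    using partition_nonneg assms by (simp add: realization_def nerve_map_support) (simp add: nerve_map_def)
qed

lemma continuous_map_nerve_map_component:
  "continuous_map X euclideanreal (\<lambda>x. nerve_map \<U> \<phi> x U)"
  using continuous_map_partition by (cases "U \<in> \<U>") (simp_all add: nerve_map_def)

lemma nerve_map_locally_finite:
  "x \<in> topspace X \<Longrightarrow> \<exists>N. openin X N \<and> x \<in> N \<and> finite {U. \<exists>y\<in>N. nerve_map \<U> \<phi> y U \<noteq> 0}"
proof -
  have "{U. \<exists>y\<in>N. nerve_map \<U> \<phi> y U \<noteq> 0} = {U\<in>\<U>. \<exists>y\<in>N. \<phi> U y \<noteq> 0}" for N
    by (auto simp: nerve_map_def)
  then show "x \<in> topspace X \<Longrightarrow> ?thesis" using partition_locally_finite[of x] by simp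
qed

lemma continuous_map_nerve_map: "continuous_map X (weak_topology (nerve \<U>)) (nerve_map \<U> \<phi>)"
  by (rule continuous_map_weak_topology)
    (auto intro: continuous_map_nerve_map_component nerve_map_in_realization nerve_map_locally_finite)

text \<open>The coordinates are nonnegative and add up to 1, and the one of \<open>U0\<close> already equals 1.\<close>

lemma nerve_map_base:
  assumes "U0 \<in> \<U>" "x0 \<in> topspace X"
  shows "nerve_map \<U> \<phi> x0 = vertex_point U0"
proof -
  let ?S = "{U\<in>\<U>. \<phi> U x0 \<noteq> 0}"
  have U0: "U0 \<in> ?S" using assms partition_base by simp
  have "(\<Sum>U\<in>?S - {U0}. \<phi> U x0) = 0"
    using partition_sum[OF assms(2)] sum.remove[OF partition_finite[OF assms(2)] U0, of "\<lambda>U. \<phi> U x0"]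
      partition_base by simp
  then have "\<phi> U x0 = 0" if "U \<in> ?S - {U0}" for U
    using that partition_finite[OF assms(2)] partition_nonneg assms(2)
    by (subst (asm) sum_nonneg_eq_0_iff) auto
  then show ?thesis
    using partition_base assms(1) by (fastforce simp: nerve_map_def vertex_point_def)
qed

text \<open>The homotopy \<open>F\<close> moves the image of the loop straight to the vertex \<open>U\<close>.  Near each point of the
  square its support lies in a finite set: the finitely many indices of the partition of unity that
  matter near the corresponding point of the loop, together with \<open>U\<close>.\<close>

lemma loop_in_star_null_homotopic:
  assumes U: "U \<in> \<U>"
    and \<gamma>: "loop_at (subtopology X {x \<in> topspace X. \<phi> U x \<noteq> 0}) z \<gamma>"
  shows "path_homotopic (weak_topology (nerve \<U>)) (nerve_map \<U> \<phi> \<circ> \<gamma>) (\<lambda>t. nerve_map \<U> \<phi> z)"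
proof -
  let ?f = "nerve_map \<U> \<phi>"
  let ?F = "\<lambda>z V. (1 - fst z) * ?f (\<gamma> (snd z)) V + fst z * vertex_point U V"
  have \<gamma>_path: "pathin X \<gamma>" and ends: "\<gamma> 0 = z" "\<gamma> 1 = z"
    and star: "\<And>s. s \<in> {0..1} \<Longrightarrow> \<gamma> s \<in> topspace X \<and> \<phi> U (\<gamma> s) \<noteq> 0"
    using \<gamma> by (auto simp: loop_at_def pathin_subtopology)
  have \<gamma>_snd: "continuous_map unit_square X (\<gamma> \<circ> snd)"
    using \<gamma>_path unfolding pathin_def by (rule continuous_map_compose[OF continuous_map_snd])
  have "continuous_map unit_square (weak_topology (nerve \<U>)) ?F"
  proof (rule continuous_map_weak_topology)
    fix V
    have "continuous_map unit_square euclideanreal (\<lambda>z. ?f (\<gamma> (snd z)) V)"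
      using continuous_map_compose[OF \<gamma>_snd continuous_map_nerve_map_component] by (simp add: o_def)
    moreover have "continuous_map unit_square euclideanreal fst"
      by (auto intro: continuous_on_fst continuous_on_id)
    ultimately show "continuous_map unit_square euclideanreal (\<lambda>z. ?F z V)"
      by (intro continuous_map_add continuous_map_real_mult continuous_map_diff) auto
  next
    show "?F \<in> topspace unit_square \<rightarrow> realization (nerve \<U>)"
    proof
      fix y assume "y \<in> topspace unit_square"
      then have y: "fst y \<in> {0..1}" "snd y \<in> {0..1}" by auto
      have "?f (\<gamma> (snd y)) U \<noteq> 0" using star[OF y(2)] U by (simp add: nerve_map_def)
      with y star[OF y(2)] show "?F y \<in> realization (nerve \<U>)"
        by (intro segment_to_vertex_in_nerve nerve_map_in_realization) auto
    qed
  next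
    fix y assume y: "y \<in> topspace unit_square"
    then have "\<gamma> (snd y) \<in> topspace X" using star by auto
    then obtain N where N: "openin X N" "\<gamma> (snd y) \<in> N" "finite {V. \<exists>x\<in>N. ?f x V \<noteq> 0}"
      using nerve_map_locally_finite by blast
    let ?N = "{y \<in> topspace unit_square. (\<gamma> \<circ> snd) y \<in> N}"
    have "{V. \<exists>y\<in>?N. ?F y V \<noteq> 0} \<subseteq> insert U {V. \<exists>x\<in>N. ?f x V \<noteq> 0}"
      by (auto simp: vertex_point_def)
    then have "finite {V. \<exists>y\<in>?N. ?F y V \<noteq> 0}"
      using N(3) by (auto intro: finite_subset)
    moreover have "openin unit_square ?N"
      by (rule openin_continuous_map_preimage[OF \<gamma>_snd N(1)])
    ultimately show "\<exists>N. openin unit_square N \<and> y \<in> N \<and> finite {V. \<exists>y\<in>N. ?F y V \<noteq> 0}"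
      using y N(2) by (intro exI[of _ ?N]) auto
  qed
  then have "path_homotopic (weak_topology (nerve \<U>)) (?f \<circ> \<gamma>) (\<lambda>t. (?f \<circ> \<gamma>) 0)"
    by (rule path_homotopic_const_if_freely_null[where c = "vertex_point U"]) (auto simp: ends)
  then show ?thesis by (simp add: ends)
qed

lemma open_cover_partition:
  "open_cover X ((\<lambda>U. {x \<in> topspace X. \<phi> U x \<noteq> 0}) ` \<U>)"
proof -
  have "openin X {x \<in> topspace X. \<phi> U x \<noteq> 0}" if "U \<in> \<U>" for U
    using openin_continuous_map_preimage[OF continuous_map_partition[OF that], of "- {0}"]
    by (simp add: open_Compl)
  moreover have "\<exists>U\<in>\<U>. \<phi> U x \<noteq> 0" if "x \<in> topspace X" for x
    using partition_sum[OF that] by (metis (mono_tags, lifting) empty_Collect_eq sum.empty zero_neq_one)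
  ultimately show ?thesis by (auto simp: open_cover_def)
qed

lemma closedin_kernel_nerve_map:
  assumes "x \<in> topspace X"
  shows "closedin (fundamental_group_topology X x)
    (kernel (fundamental_group X x)
      (fundamental_group (weak_topology (nerve \<U>)) (nerve_map \<U> \<phi> x))
      (induced_map (weak_topology (nerve \<U>)) (nerve_map \<U> \<phi>)))"
  by (rule closedin_kernel_induced_map[OF assms continuous_map_nerve_map open_cover_partition])
    (auto intro: loop_in_star_null_homotopic)

end

lemma kernel_natural_map:
  "kernel G (cech_group X x0 r) (natural_map X x0 \<phi>) =
     carrier G \<inter> (\<Inter>s\<in>cech_index X x0.
       kernel G (fundamental_group (cech_space s) (cech_point s))
         (induced_map (cech_space s) (nerve_map (fst s) (\<phi> s))))"
proof -
  have "natural_map X x0 \<phi> A = \<one>\<^bsub>cech_group X x0 r\<^esub> \<longleftrightarrow>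
      (\<forall>s\<in>cech_index X x0. induced_map (cech_space s) (nerve_map (fst s) (\<phi> s)) A
        = \<one>\<^bsub>fundamental_group (cech_space s) (cech_point s)\<^esub>)" for A
    unfolding natural_map_def cech_group_def Let_def
    by (auto simp: restrict_def fun_eq_iff)
  then show ?thesis by (auto simp: kernel_def)
qed

theorem corollary4p10:
  fixes X :: "'a topology" and x0 :: 'a and Y :: "'b topology" and y0 :: 'b
  assumes "x0 \<in> topspace X"
  shows
    "(\<forall>H \<U>. subgroup H (fundamental_group X x0) \<and> open_cover X \<U> \<and> cover_group X \<U> x0 \<subseteq> H
        \<longrightarrow> closedin (fundamental_group_topology X x0) H)
   \<and> (\<forall>S. (\<forall>\<U>\<in>S. open_cover X \<U>)
        \<longrightarrow> closedin (fundamental_group_topology X x0)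
              (carrier (fundamental_group X x0) \<inter> (\<Inter>\<U>\<in>S. cover_group X \<U> x0)))
   \<and> (\<forall>f. continuous_map X Y f \<and> f x0 = y0 \<and> semilocally_simply_connected Y
        \<longrightarrow> closedin (fundamental_group_topology X x0)
              (kernel (fundamental_group X x0) (fundamental_group Y y0) (induced_map Y f)))
   \<and> (\<forall>r \<phi>. cech_choices X x0 r \<phi>
        \<longrightarrow> closedin (fundamental_group_topology X x0)
              (kernel (fundamental_group X x0) (cech_group X x0 r) (natural_map X x0 \<phi>)))"
proof (intro conjI allI impI; (elim conjE)?)
  let ?G = "fundamental_group X x0"
  fix H \<U> assume "subgroup H ?G" "open_cover X \<U>" "cover_group X \<U> x0 \<subseteq> H"
  then show "closedin (fundamental_group_topology X x0) H"
    by (rule closedin_subgroup_if_cover_group_subset[OF assms])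
next
  fix S :: "'a set set set" assume S: "\<forall>\<U>\<in>S. open_cover X \<U>"
  have "closedin (fundamental_group_topology X x0) (cover_group X \<U> x0)" if "\<U> \<in> S" for \<U>
    using closedin_subgroup_if_cover_group_subset[OF assms subgroup_cover_group[OF assms]] S that
    by blast
  then show "closedin (fundamental_group_topology X x0)
      (carrier (fundamental_group X x0) \<inter> (\<Inter>\<U>\<in>S. cover_group X \<U> x0))"
    unfolding topspace_fundamental_group_topology[symmetric] by (rule closedin_topspace_Inter)
next
  fix f :: "'a \<Rightarrow> 'b"
  assume "continuous_map X Y f" "f x0 = y0" "semilocally_simply_connected Y"
  then show "closedin (fundamental_group_topology X x0)
      (kernel (fundamental_group X x0) (fundamental_group Y y0) (induced_map Y f))"
    using closedin_kernel_semilocally_simply_connected[OF assms] by blast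
next
  fix r :: "'a set set \<times> 'a set \<Rightarrow> 'a set set \<times> 'a set \<Rightarrow> 'a set \<Rightarrow> 'a set"
    and \<phi> :: "'a set set \<times> 'a set \<Rightarrow> 'a set \<Rightarrow> 'a \<Rightarrow> real"
  assume choices: "cech_choices X x0 r \<phi>"
  have "closedin (fundamental_group_topology X x0)
      (kernel (fundamental_group X x0) (fundamental_group (cech_space s) (cech_point s))
        (induced_map (cech_space s) (nerve_map (fst s) (\<phi> s))))" if s: "s \<in> cech_index X x0" for s
  proof -
    obtain \<U> U0 where s_eq: "s = (\<U>, U0)" by fastforce
    with choices s have part: "pointed_partition_of_unity X x0 (\<U>, U0) (\<phi> s)" and "U0 \<in> \<U>"
      by (auto simp: cech_choices_def cech_index_def)
    then have "nerve_map \<U> (\<phi> s) x0 = cech_point s"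
      using nerve_map_base assms by (simp add: s_eq cech_point_def)
    with closedin_kernel_nerve_map[OF part assms] show ?thesis
      by (simp add: s_eq cech_space_def)
  qed
  then show "closedin (fundamental_group_topology X x0)
      (kernel (fundamental_group X x0) (cech_group X x0 r) (natural_map X x0 \<phi>))"
    unfolding kernel_natural_map topspace_fundamental_group_topology[symmetric]
    by (rule closedin_topspace_Inter)
qed

end
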